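(* Let $(M,d)$ be a compact metric space, let $\mathbf{p}=(p_0,\ldots,p_{N-1})$ be a non-degenerate probability vector, and let $\mathcal{F}=\{f_0,\ldots,f_{N-1}\}$, $N\ge 2$, be a finite family of Lipschitz maps $f_i\colon M\to M$ such that $(\mathcal{F},\mathbf{p},d)$ is non-expansive on average (NEA). If $(\mathcal{F},\mathbf{p},d)$ satisfies LECA and ESCA, then there exist $\lambda\in(0,1)$ and $n\in\mathbb{N}$ such that $(\mathcal{F},\mathbf{p},d_{n,\lambda})$ is contracting on average (CA). Moreover, for $(\mathcal{F},\mathbf{p},d)$ as in the first sentence (before assuming LECA and ESCA), LECA is equivalent to SA.
   Context: $\mathbf{p}$ is non-degenerate if $p_i>0$ for all $i$ (and $\sum_i p_i=1$). Let $\Sigma_N^+=\{0,\ldots,N-1\}^{\mathbb{N}}$, $\mathbb{N}=\{1,2,\ldots\}$, and let $\mu$ be the Bernoulli measure on $\Sigma_N^+$ determined by $\mathbf{p}$; $\mathbb{E}(X)=\int X\,d\mu$. For $\xi=(\xi_1\xi_2\ldots)\in\Sigma_N^+$ put $f_\xi^n=f_{\xi_n}\circ\cdots\circ f_{\xi_1}$, $f_\xi^0=\mathrm{id}$. For a metric $\rho$ on $M$, $x,y\in M$ and $n\ge 0$ put $Z_{n,\rho}^{x,y}(\xi)=\rho(f_\xi^n(x),f_\xi^n(y))$. For a metric $\rho$ on $M$, the triple $(\mathcal{F},\mathbf{p},\rho)$ is said to be: - CA (contracting on average) if there is $\lambda\in(0,1)$ with $\mathbb{E}(Z_{1,\rho}^{x,y})\le\lambda\rho(x,y)$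 for all $x,y\in M$; - NEA (non-expansive on average) if $\mathbb{E}(Z_{1,\rho}^{x,y})\le\rho(x,y)$ for all $x,y\in M$; - SA (synchronizing on average) if $\lim_{n\to\infty}\mathbb{E}(Z_{n,\rho}^{x,y})=0$ for all $x,y\in M$; - LECA (locally eventually contractive on average) if for every $x,y\in M$ there exist $\ell\ge1$ and $\lambda\in(0,1)$ (depending on $x,y$) with $\mathbb{E}(Z_{\ell,\rho}^{x,y})\le\lambda\rho(x,y)$; - ESCA (eventually strongly contracting on average) if for every $x\in M$ there exist $\ell\ge1$ and an open neighborhood $V\subset M\times M$ of $(x,x)$ such that $\sup_{(y,z)\in V,\,y\ne z}\mathbb{E}(Z_{\ell,\rho}^{z,y})/\rho(z,y)<1$. For $\lambda>0$ and $n\in\mathbb{N}$, $d_{n,\lambda}$ is the metric $$d_{n,\lambda}(x,y)=\sum_{j=0}^{n-1}\lambda^{-j/n}\,\mathbb{E}(Z_{j,d}^{x,y}).$$ *)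

theory Defs
  imports "HOL-Probability.Probability"
begin

section \<open>Random iteration of finitely many maps\<close>

text \<open>
  Maps and probability vectors are indexed by all of \<open>nat\<close>; only the indices \<open>i < N\<close> are used.
\<close>

definition nondegenerate :: "nat \<Rightarrow> (nat \<Rightarrow> real) \<Rightarrow> bool" where
  "nondegenerate N p \<longleftrightarrow> (\<forall>i<N. p i > 0) \<and> (\<Sum>i<N. p i) = 1"

text \<open>
  The space of this measure consists of the functions from the positive integers to
  \<open>{0,\<dots>,N-1}\<close>, represented as elements of \<open>{1..} \<rightarrow>\<^sub>E {..<N}\<close>
  (their value at \<open>0\<close> is the dummy \<open>undefined\<close>).
\<close>

definition bernoulli_measure :: "nat \<Rightarrow> (nat \<Rightarrow> real) \<Rightarrow> (nat \<Rightarrow> nat) measure" where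
  "bernoulli_measure N p = (\<Pi>\<^sub>M k\<in>{1..}. point_measure {..<N} (\<lambda>i. ennreal (p i)))"

primrec fiter :: "(nat \<Rightarrow> 'a \<Rightarrow> 'a) \<Rightarrow> (nat \<Rightarrow> nat) \<Rightarrow> nat \<Rightarrow> 'a \<Rightarrow> 'a" where
  "fiter f \<xi> 0 = id"
| "fiter f \<xi> (Suc n) = f (\<xi> (Suc n)) \<circ> fiter f \<xi> n"

definition Z :: "(nat \<Rightarrow> 'a \<Rightarrow> 'a) \<Rightarrow> ('a \<Rightarrow> 'a \<Rightarrow> real) \<Rightarrow> nat \<Rightarrow> 'a \<Rightarrow> 'a \<Rightarrow> (nat \<Rightarrow> nat) \<Rightarrow> real" where
  "Z f \<rho> n x y \<xi> = \<rho> (fiter f \<xi> n x) (fiter f \<xi> n y)"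

definition EZ ::
  "nat \<Rightarrow> (nat \<Rightarrow> 'a \<Rightarrow> 'a) \<Rightarrow> (nat \<Rightarrow> real) \<Rightarrow> ('a \<Rightarrow> 'a \<Rightarrow> real) \<Rightarrow> nat \<Rightarrow> 'a \<Rightarrow> 'a \<Rightarrow> real" where
  "EZ N f p \<rho> n x y = (LINT \<xi>|bernoulli_measure N p. Z f \<rho> n x y \<xi>)"


section \<open>Contraction and synchronization properties\<close>

text \<open>
  The argument \<open>\<rho>\<close> is meant to be a metric on the whole type; topological notions always refer
  to the ambient topology of the type, not to \<open>\<rho>\<close>.
\<close>

definition CA :: "nat \<Rightarrow> (nat \<Rightarrow> 'a \<Rightarrow> 'a) \<Rightarrow> (nat \<Rightarrow> real) \<Rightarrow> ('a \<Rightarrow> 'a \<Rightarrow> real) \<Rightarrow> bool" where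
  "CA N f p \<rho> \<longleftrightarrow> (\<exists>c\<in>{0<..<1}. \<forall>x y. EZ N f p \<rho> 1 x y \<le> c * \<rho> x y)"

definition NEA :: "nat \<Rightarrow> (nat \<Rightarrow> 'a \<Rightarrow> 'a) \<Rightarrow> (nat \<Rightarrow> real) \<Rightarrow> ('a \<Rightarrow> 'a \<Rightarrow> real) \<Rightarrow> bool" where
  "NEA N f p \<rho> \<longleftrightarrow> (\<forall>x y. EZ N f p \<rho> 1 x y \<le> \<rho> x y)"

definition SA :: "nat \<Rightarrow> (nat \<Rightarrow> 'a \<Rightarrow> 'a) \<Rightarrow> (nat \<Rightarrow> real) \<Rightarrow> ('a \<Rightarrow> 'a \<Rightarrow> real) \<Rightarrow> bool" where
  "SA N f p \<rho> \<longleftrightarrow> (\<forall>x y. (\<lambda>n. EZ N f p \<rho> n x y) \<longlonglongrightarrow> 0)"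

definition LECA :: "nat \<Rightarrow> (nat \<Rightarrow> 'a \<Rightarrow> 'a) \<Rightarrow> (nat \<Rightarrow> real) \<Rightarrow> ('a \<Rightarrow> 'a \<Rightarrow> real) \<Rightarrow> bool" where
  "LECA N f p \<rho> \<longleftrightarrow> (\<forall>x y. \<exists>l\<ge>1. \<exists>c\<in>{0<..<1}. EZ N f p \<rho> l x y \<le> c * \<rho> x y)"

text \<open>
  The supremum is taken in \<open>ereal\<close>: it is \<open>\<infinity>\<close> for an unbounded set of quotients, and \<open>- \<infinity>\<close>
  (hence less than \<open>1\<close>) when \<open>V\<close> contains no off-diagonal pair, e.g. at an isolated point.
\<close>

definition ESCA ::
  "nat \<Rightarrow> (nat \<Rightarrow> 'a::topological_space \<Rightarrow> 'a) \<Rightarrow> (nat \<Rightarrow> real) \<Rightarrow> ('a \<Rightarrow> 'a \<Rightarrow> real) \<Rightarrow> bool" where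
  "ESCA N f p \<rho> \<longleftrightarrow>
     (\<forall>x. \<exists>l\<ge>1. \<exists>V. open V \<and> (x, x) \<in> V \<and>
        (SUP (y, z)\<in>{(y, z). (y, z) \<in> V \<and> y \<noteq> z}. ereal (EZ N f p \<rho> l z y / \<rho> z y)) < 1)"


section \<open>The adapted metrics\<close>

definition adapted_dist ::
  "nat \<Rightarrow> (nat \<Rightarrow> 'a::metric_space \<Rightarrow> 'a) \<Rightarrow> (nat \<Rightarrow> real) \<Rightarrow> nat \<Rightarrow> real \<Rightarrow> 'a \<Rightarrow> 'a \<Rightarrow> real" where
  "adapted_dist N f p n c x y = (\<Sum>j<n. c powr (- (real j / real n)) * EZ N f p dist j x y)"

lemma prob_space_bernoulli_measure:
  assumes "nondegenerate N p"
  shows "prob_space (bernoulli_measure N p)"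
proof -
  have "(\<Sum>i<N. ennreal (p i)) = ennreal (\<Sum>i<N. p i)"
    using assms by (intro sum_ennreal) (auto simp: nondegenerate_def less_imp_le)
  then have "prob_space (point_measure {..<N} (\<lambda>i. ennreal (p i)))"
    using assms by (intro prob_spaceI)
      (simp add: space_point_measure emeasure_point_measure_finite nondegenerate_def)
  then show ?thesis
    unfolding bernoulli_measure_def by (intro prob_space_PiM)
qed

lemma measurable_fiter:
  "(\<lambda>\<xi>. fiter f \<xi> n x) \<in> measurable (bernoulli_measure N p) (count_space UNIV)"
proof (induction n)
  case 0
  then show ?case by simp
next
  case (Suc n)
  let ?B = "bernoulli_measure N p"
  have "(\<lambda>\<xi>. \<xi> (Suc n)) \<in> measurable ?B (point_measure {..<N} (\<lambda>i. ennreal (p i)))"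
    unfolding bernoulli_measure_def by (intro measurable_component_singleton) simp
  also have "\<dots> = measurable ?B (count_space {..<N})"
    by (intro measurable_cong_sets) (auto simp: sets_point_measure)
  finally have coord: "(\<lambda>\<xi>. \<xi> (Suc n)) \<in> measurable ?B (count_space {..<N})" .
  have "(\<lambda>\<xi>. f i (fiter f \<xi> n x)) \<in> measurable ?B (count_space UNIV)" for i
    by (rule measurable_compose[OF Suc]) simp
  then show ?case
    using measurable_compose_countable'[of "{..<N}" "\<lambda>i \<xi>. f i (fiter f \<xi> n x)", OF _ coord]
    by simp
qed

lemma finite_fiter:
  "finite ((\<lambda>\<xi>. fiter f \<xi> n x) ` space (bernoulli_measure N p))"
proof (induction n)
  case 0
  show ?case by (rule finite_subset[of _ "{x}"]) auto
next
  case (Suc n)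
  let ?S = "space (bernoulli_measure N p)"
  have "\<xi> (Suc n) < N" if "\<xi> \<in> ?S" for \<xi>
    using that by (auto simp: bernoulli_measure_def space_PiM space_point_measure PiE_iff)
  then have "(\<lambda>\<xi>. fiter f \<xi> (Suc n) x) ` ?S
      \<subseteq> (\<lambda>(i, u). f i u) ` ({..<N} \<times> (\<lambda>\<xi>. fiter f \<xi> n x) ` ?S)"
    by force
  then show ?case
    by (rule finite_subset) (use Suc in auto)
qed

lemma integrable_Z:
  assumes "nondegenerate N p"
  shows "integrable (bernoulli_measure N p) (Z f \<rho> n x y)"
proof -
  let ?B = "bernoulli_measure N p"
  interpret prob_space ?B
    using assms by (rule prob_space_bernoulli_measure)
  define I where "I = (\<lambda>u. (\<lambda>\<xi>. fiter f \<xi> n u) ` space ?B)"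
  have fin: "finite (I u)" for u
    unfolding I_def by (rule finite_fiter)
  have meas: "(\<lambda>\<xi>. fiter f \<xi> n u) \<in> measurable ?B (count_space (I u))" for u
    using measurable_sets[OF measurable_fiter[of f n u N p]] fin[of u]
    by (subst measurable_count_space_eq2) (auto simp: I_def)
  have "(\<lambda>\<xi>. \<rho> u (fiter f \<xi> n y)) \<in> borel_measurable ?B" for u
    by (rule measurable_compose[OF measurable_fiter]) simp
  then have m: "Z f \<rho> n x y \<in> borel_measurable ?B"
    using measurable_compose_countable'[of "I x" "\<lambda>u \<xi>. \<rho> u (fiter f \<xi> n y)", OF _ meas] fin
    by (simp add: Z_def[abs_def] countable_finite)
  have "Z f \<rho> n x y ` space ?B \<subseteq> (\<lambda>(u, v). \<rho> u v) ` (I x \<times> I y)"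
    by (force simp: Z_def I_def)
  then have "finite (Z f \<rho> n x y ` space ?B)"
    by (rule finite_subset) (use fin in auto)
  then have "bounded (Z f \<rho> n x y ` space ?B)"
    by (rule finite_imp_bounded)
  then obtain C where "\<And>\<xi>. \<xi> \<in> space ?B \<Longrightarrow> norm (Z f \<rho> n x y \<xi>) \<le> C"
    by (auto simp: bounded_iff)
  then show ?thesis
    by (intro integrable_const_bound[where B = C] m) auto
qed

lemma Metric_space_adapted_dist:
  fixes f :: "nat \<Rightarrow> 'a::metric_space \<Rightarrow> 'a"
  assumes p: "nondegenerate N p" and c: "c > 0" and n: "n \<ge> 1"
  shows "Metric_space UNIV (adapted_dist N f p n c)"
proof
  let ?B = "bernoulli_measure N p"
  interpret prob_space ?B
    using p by (rule prob_space_bernoulli_measure)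
  have nonneg: "EZ N f p dist j x y \<ge> 0" for j x y
    unfolding EZ_def by (rule Bochner_Integration.integral_nonneg) (simp add: Z_def)
  fix x y z :: 'a
  show "0 \<le> adapted_dist N f p n c x y"
    unfolding adapted_dist_def by (intro sum_nonneg mult_nonneg_nonneg nonneg) simp
  show "adapted_dist N f p n c x y = adapted_dist N f p n c y x"
    unfolding adapted_dist_def EZ_def Z_def by (simp add: dist_commute)
  have tri: "EZ N f p dist j x z \<le> EZ N f p dist j x y + EZ N f p dist j y z" for j
  proof -
    have "EZ N f p dist j x z \<le> (LINT \<xi>|?B. Z f dist j x y \<xi> + Z f dist j y z \<xi>)"
      unfolding EZ_def
      by (intro integral_mono integrable_Z Bochner_Integration.integrable_add p)
        (simp add: Z_def dist_triangle)
    then show ?thesis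
      by (simp add: EZ_def integrable_Z[OF p])
  qed
  show "adapted_dist N f p n c x z \<le> adapted_dist N f p n c x y + adapted_dist N f p n c y z"
    unfolding adapted_dist_def sum.distrib[symmetric] distrib_left[symmetric]
    by (intro sum_mono mult_left_mono tri) simp
  have "c powr (- (real 0 / real n)) * EZ N f p dist 0 x y \<le> adapted_dist N f p n c x y"
    unfolding adapted_dist_def
    by (rule member_le_sum) (use n nonneg in auto)
  then have "dist x y \<le> adapted_dist N f p n c x y"
    using c by (simp add: EZ_def Z_def[abs_def] prob_space)
  then show "adapted_dist N f p n c x y = 0 \<longleftrightarrow> x = y"
    by (auto simp: adapted_dist_def EZ_def Z_def[abs_def])
qed

end

theory Submission
  imports Defs
begin

text \<open>
  Expectations along the random orbit are iterates of the averaging operator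
  \<open>(A\<rho>)(x, y) = (\<Sum>i<N. p i * \<rho> (f i x) (f i y))\<close>, which is linear and monotone and preserves
  constants. Under NEA the functions \<open>E n = A\<^sup>n dist\<close> decrease in \<open>n\<close>, so by compactness pointwise
  contraction becomes uniform: on every compact set of pairs on which contraction holds locally,
  \<open>E l \<le> c * dist\<close> with one \<open>l\<close> and one \<open>c < 1\<close>.

  For LECA \<open>\<Longrightarrow>\<close> SA, apply this to the pairs at distance at least \<open>\<delta>\<close>. It gives
  \<open>dist \<le> \<delta> + (dist - E l) / (1 - c)\<close> for all pairs, hence
  \<open>E k \<le> \<delta> + (E k - E (k + l)) / (1 - c)\<close> on applying \<open>A\<^sup>k\<close>, and the difference tends to \<open>0\<close>.

  Under LECA and ESCA the uniform estimate holds on the whole square; then \<open>A\<close> shifts the weighted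
  sum defining the adapted metric by one index, which contracts it by \<open>c powr (1 / l)\<close>.
\<close>

section \<open>The averaging operator\<close>

definition avg :: "nat \<Rightarrow> (nat \<Rightarrow> 'a \<Rightarrow> 'a) \<Rightarrow> (nat \<Rightarrow> real) \<Rightarrow> ('a \<Rightarrow> 'a \<Rightarrow> real) \<Rightarrow> 'a \<Rightarrow> 'a \<Rightarrow> real" where
  "avg N f p \<rho> x y = (\<Sum>i<N. p i * \<rho> (f i x) (f i y))"

section \<open>Reduction of the Bernoulli integral to finitely many coordinates\<close>

lemma fiter_cong:
  assumes "\<And>k. 1 \<le> k \<Longrightarrow> k \<le> n \<Longrightarrow> \<xi> k = \<eta> k"
  shows "fiter f \<xi> n = fiter f \<eta> n"
  using assms by (induction n) auto

text \<open>The product is a finite space with measurable singletons, so each of its subsets is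
  measurable. This lets \<open>Z\<close> be integrated for an arbitrary
  \<open>\<rho>\<close>.\<close>

lemma borel_measurable_PiM_point_measure:
  fixes g :: "('i \<Rightarrow> 'b) \<Rightarrow> 'c::topological_space"
  assumes "finite J" "finite A"
  shows "g \<in> borel_measurable (\<Pi>\<^sub>M i\<in>J. point_measure A q)"
proof (rule measurableI)
  let ?P = "\<Pi>\<^sub>M i\<in>J. point_measure A q"
  have fin: "finite (space ?P)"
    using assms by (simp add: space_PiM space_point_measure finite_PiE)
  have sing: "{w} \<in> sets ?P" if "w \<in> space ?P" for w
  proof -
    have w: "w \<in> (\<Pi>\<^sub>E i\<in>J. A)"
      using that by (simp add: space_PiM space_point_measure)
    then have "{w} = (\<Pi>\<^sub>E i\<in>J. {w i})"
      by (subst PiE_singleton) (auto simp: PiE_iff)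
    also have "\<dots> \<in> sets ?P"
      using assms w by (intro sets_PiM_I_finite) (auto simp: sets_point_measure PiE_iff)
    finally show ?thesis .
  qed
  fix B :: "'c set"
  show "g -` B \<inter> space ?P \<in> sets ?P"
  proof (rule sets.countable)
    show "countable (g -` B \<inter> space ?P)"
      using fin by (intro countable_finite) auto
  qed (simp add: sing)
qed simp

lemma product_prob_space_point_measure:
  assumes "nondegenerate N p"
  shows "product_prob_space (\<lambda>_. point_measure {..<N} (\<lambda>i. ennreal (p i)))"
proof -
  have "(\<Sum>i<N. ennreal (p i)) = ennreal (\<Sum>i<N. p i)"
    using assms by (intro sum_ennreal) (auto simp: nondegenerate_def less_imp_le)
  then have "prob_space (point_measure {..<N} (\<lambda>i. ennreal (p i)))"
    using assms by (intro prob_spaceI)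
      (simp add: space_point_measure emeasure_point_measure_finite nondegenerate_def)
  then show ?thesis
    by (intro product_prob_spaceI)
qed

text \<open>At time \<open>n\<close>, \<open>Z\<close> reads only the coordinates \<open>1\<close>
  to \<open>n\<close>, whose joint law is the finite product. Fubini then applies one coordinate at
  a time.\<close>

lemma EZ_eq_PiM:
  assumes p: "nondegenerate N p"
  shows "EZ N f p \<rho> n x y
    = (LINT w|(\<Pi>\<^sub>M k\<in>{1..n}. point_measure {..<N} (\<lambda>i. ennreal (p i))). Z f \<rho> n x y w)"
    (is "_ = (LINT w|?P. _)")
proof -
  interpret product_prob_space "\<lambda>_. point_measure {..<N} (\<lambda>i. ennreal (p i))" "{1::nat..}"
    using p by (rule product_prob_space_point_measure)
  let ?B = "bernoulli_measure N p"
  have d: "distr ?B ?P (\<lambda>\<xi>. restrict \<xi> {1..n}) = ?P"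
    unfolding bernoulli_measure_def by (rule distr_PiM_restrict_finite) auto
  have "(LINT w|?P. Z f \<rho> n x y w) = (LINT w|distr ?B ?P (\<lambda>\<xi>. restrict \<xi> {1..n}). Z f \<rho> n x y w)"
    by (simp only: d)
  also have "\<dots> = (LINT \<xi>|?B. Z f \<rho> n x y (restrict \<xi> {1..n}))"
  proof (rule integral_distr)
    show "(\<lambda>\<xi>. restrict \<xi> {1..n}) \<in> measurable ?B ?P"
      unfolding bernoulli_measure_def by (rule measurable_restrict_subset) auto
    show "Z f \<rho> n x y \<in> borel_measurable ?P"
      by (rule borel_measurable_PiM_point_measure) auto
  qed
  also have "\<dots> = (LINT \<xi>|?B. Z f \<rho> n x y \<xi>)"
  proof -
    have "fiter f (restrict \<xi> {1..n}) n = fiter f \<xi> n" for \<xi>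
      by (rule fiter_cong) simp
    then show ?thesis by (simp add: Z_def)
  qed
  finally show ?thesis by (simp add: EZ_def)
qed

lemma EZ_0:
  assumes "nondegenerate N p"
  shows "EZ N f p \<rho> 0 = \<rho>"
proof -
  interpret prob_space "bernoulli_measure N p"
    using assms by (rule prob_space_bernoulli_measure)
  show ?thesis
    by (simp add: EZ_def Z_def fun_eq_iff prob_space)
qed

text \<open>Coordinate \<open>Suc n\<close> selects the map applied last, so integrating it out
  first averages \<open>\<rho>\<close> at the endpoints of the orbits of length
  \<open>n\<close>.\<close>

lemma EZ_Suc_avg:
  assumes p: "nondegenerate N p"
  shows "EZ N f p \<rho> (Suc n) = EZ N f p (avg N f p \<rho>) n"
proof (intro ext)
  fix x y
  let ?m = "point_measure {..<N} (\<lambda>i. ennreal (p i))"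
  interpret product_prob_space "\<lambda>_. ?m" "{1::nat..}"
    using p by (rule product_prob_space_point_measure)
  let ?P = "\<lambda>n. \<Pi>\<^sub>M k\<in>{1..n::nat}. ?m"
  have ins: "{1..Suc n} = insert (Suc n) {1..n}" by auto
  have "prob_space (?P (Suc n))"
    by (intro prob_space_PiM M.prob_space_axioms)
  then have fin: "finite_measure (?P (Suc n))"
    by (rule prob_space.finite_measure)
  have "finite (Z f \<rho> (Suc n) x y ` space (?P (Suc n)))"
    by (intro finite_imageI) (simp add: space_PiM space_point_measure finite_PiE)
  then have "bounded (Z f \<rho> (Suc n) x y ` space (?P (Suc n)))"
    by (rule finite_imp_bounded)
  then obtain C where "\<And>w. w \<in> space (?P (Suc n)) \<Longrightarrow> norm (Z f \<rho> (Suc n) x y w) \<le> C"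
    by (auto simp: bounded_iff)
  then have int: "integrable (?P (Suc n)) (Z f \<rho> (Suc n) x y)"
    by (intro finite_measure.integrable_const_bound[OF fin, where B = C] borel_measurable_PiM_point_measure) auto
  have upd: "fiter f (w(Suc n := i)) n = fiter f w n" for w i
    by (rule fiter_cong) simp
  have "EZ N f p \<rho> (Suc n) x y = (LINT w|?P (Suc n). Z f \<rho> (Suc n) x y w)"
    by (rule EZ_eq_PiM[OF p])
  also have "\<dots> = (LINT w|?P n. (LINT i|?m. Z f \<rho> (Suc n) x y (w(Suc n := i))))"
    using int unfolding ins by (intro product_integral_insert) auto
  also have "\<dots> = (LINT w|?P n. Z f (avg N f p \<rho>) n x y w)"
  proof (rule Bochner_Integration.integral_cong[OF refl])
    fix w
    have "(LINT i|?m. Z f \<rho> (Suc n) x y (w(Suc n := i)))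
        = (\<Sum>i<N. p i *\<^sub>R Z f \<rho> (Suc n) x y (w(Suc n := i)))"
      using p by (intro lebesgue_integral_point_measure_finite)
        (auto simp: nondegenerate_def less_imp_le)
    then show "(LINT i|?m. Z f \<rho> (Suc n) x y (w(Suc n := i))) = Z f (avg N f p \<rho>) n x y w"
      by (simp add: Z_def upd avg_def)
  qed
  also have "\<dots> = EZ N f p (avg N f p \<rho>) n x y"
    by (rule EZ_eq_PiM[OF p, symmetric])
  finally show "EZ N f p \<rho> (Suc n) x y = EZ N f p (avg N f p \<rho>) n x y" .
qed

lemma EZ_eq_funpow:
  assumes "nondegenerate N p"
  shows "EZ N f p \<rho> n = (avg N f p ^^ n) \<rho>"
  by (induction n arbitrary: \<rho>)
    (simp_all add: EZ_0[OF assms] EZ_Suc_avg[OF assms] funpow_swap1)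

text \<open>As the expectation is a power of \<open>avg\<close> applied to \<open>\<rho>\<close>,
  the extra average can also sit outside: this conditions on the first map instead of the
  last.\<close>

lemma EZ_Suc:
  assumes "nondegenerate N p"
  shows "EZ N f p \<rho> (Suc n) = avg N f p (EZ N f p \<rho> n)"
  by (simp add: EZ_eq_funpow[OF assms])

lemma EZ_Suc_0:
  assumes "nondegenerate N p"
  shows "EZ N f p \<rho> (Suc 0) = avg N f p \<rho>"
  by (simp add: EZ_eq_funpow[OF assms])

section \<open>Order and linearity of the averaging operator\<close>

lemma funpow_avg_mono:
  assumes p: "nondegenerate N p" and le: "\<And>x y. g x y \<le> h x y"
  shows "(avg N f p ^^ k) g x y \<le> (avg N f p ^^ k) h x y"
proof (induction k arbitrary: x y)
  case (Suc k)
  then show ?case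
    using p by (auto simp: avg_def nondegenerate_def less_imp_le intro!: sum_mono mult_left_mono)
qed (simp add: le)

text \<open>The constant \<open>a\<close> survives because the weights sum to \<open>1\<close>. The
  shape is that of the bound iterated in \<open>LECA_imp_SA\<close>.\<close>

lemma funpow_avg_affine:
  assumes p: "nondegenerate N p"
  shows "(avg N f p ^^ k) (\<lambda>x y. a + b * (g x y - h x y))
    = (\<lambda>x y. a + b * ((avg N f p ^^ k) g x y - (avg N f p ^^ k) h x y))"
proof (induction k)
  case (Suc k)
  have "(\<Sum>i<N. p i * (a + b * (u i - v i))) = a + b * ((\<Sum>i<N. p i * u i) - (\<Sum>i<N. p i * v i))"
    for u v :: "nat \<Rightarrow> real"
  proof -
    have "(\<Sum>i<N. p i * (a + b * (u i - v i)))
        = (\<Sum>i<N. p i) * a + b * ((\<Sum>i<N. p i * u i) - (\<Sum>i<N. p i * v i))"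
      by (simp add: algebra_simps sum.distrib sum_subtractf sum_distrib_left sum_distrib_right)
    then show ?thesis
      using p by (simp add: nondegenerate_def)
  qed
  then have "avg N f p (\<lambda>x y. a + b * (u x y - v x y))
      = (\<lambda>x y. a + b * (avg N f p u x y - avg N f p v x y))" for u v
    by (simp add: avg_def fun_eq_iff)
  then show ?case
    by (simp add: Suc)
qed simp


section \<open>Expected distances\<close>

lemma EZ_dist_nonneg: "0 \<le> EZ N f p dist n x y"
  unfolding EZ_def by (rule Bochner_Integration.integral_nonneg) (simp add: Z_def)

lemma EZ_dist_commute: "EZ N f p dist n x y = EZ N f p dist n y x"
  by (simp add: EZ_def Z_def dist_commute)

lemma EZ_dist_refl: "EZ N f p dist n x x = 0"
  by (simp add: EZ_def Z_def)

text \<open>NEA says that \<open>avg\<close> does not increase \<open>dist\<close>; monotonicity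
  carries this single inequality through every power of \<open>avg\<close>.\<close>

lemma decseq_EZ_dist:
  assumes p: "nondegenerate N p" and "NEA N f p dist"
  shows "decseq (\<lambda>n. EZ N f p dist n x y)"
proof (rule decseq_SucI)
  fix n
  have "(avg N f p ^^ n) (avg N f p dist) x y \<le> (avg N f p ^^ n) dist x y"
    using assms by (intro funpow_avg_mono) (auto simp: NEA_def EZ_Suc_0[OF p])
  then show "EZ N f p dist (Suc n) x y \<le> EZ N f p dist n x y"
    by (simp add: EZ_eq_funpow[OF p] funpow_swap1)
qed

lemma continuous_on_EZ_dist:
  fixes f :: "nat \<Rightarrow> 'a::metric_space \<Rightarrow> 'a"
  assumes p: "nondegenerate N p" and f: "\<And>i. i < N \<Longrightarrow> continuous_on UNIV (f i)"
  shows "continuous_on UNIV (\<lambda>z. EZ N f p dist n (fst z) (snd z))"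
proof (induction n)
  case 0
  show ?case
    by (simp add: EZ_0[OF p] continuous_intros)
next
  case (Suc n)
  have "continuous_on UNIV (\<lambda>z. EZ N f p dist n (f i (fst z)) (f i (snd z)))" if "i < N" for i
  proof -
    have "continuous_on UNIV (\<lambda>z. (f i (fst z), f i (snd z)))"
      by (intro continuous_on_Pair continuous_on_compose2[OF f[OF that]] continuous_intros) auto
    from continuous_on_compose2[OF Suc this] show ?thesis by simp
  qed
  then show ?case
    unfolding EZ_Suc[OF p] avg_def by (intro continuous_intros) auto
qed

text \<open>Finitely many of the neighborhoods cover \<open>S\<close>. Since expected distances
  decrease in time, the largest exponent serves all of them, with the largest rate.\<close>

lemma uniform_contraction:
  fixes f :: "nat \<Rightarrow> 'a::metric_space \<Rightarrow> 'a"
  assumes p: "nondegenerate N p" and nea: "NEA N f p dist" and S: "compact S"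
    and loc: "\<And>z. z \<in> S \<Longrightarrow> \<exists>l. \<exists>c<1. \<exists>U. open U \<and> z \<in> U \<and>
      (\<forall>(x, y)\<in>U. EZ N f p dist l x y \<le> c * dist x y)"
  shows "\<exists>l\<ge>1. \<exists>c\<in>{0<..<1}. \<forall>x y. (x, y) \<in> S \<longrightarrow> EZ N f p dist l x y \<le> c * dist x y"
proof -
  have "\<forall>z\<in>S. \<exists>t. case t of (l, c, U) \<Rightarrow> c < (1::real) \<and> open U \<and> z \<in> U \<and>
      (\<forall>(x, y)\<in>U. EZ N f p dist l x y \<le> c * dist x y)"
    using loc by simp
  from bchoice[OF this] obtain t where T: "\<forall>z\<in>S. case t z of (l, c, U) \<Rightarrow> c < (1::real) \<and>
      open U \<and> z \<in> U \<and> (\<forall>(x, y)\<in>U. EZ N f p dist l x y \<le> c * dist x y)" ..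
  have t: "fst (snd (t z)) < 1" "open (snd (snd (t z)))" "z \<in> snd (snd (t z))"
    "\<And>x y. (x, y) \<in> snd (snd (t z)) \<Longrightarrow>
      EZ N f p dist (fst (t z)) x y \<le> fst (snd (t z)) * dist x y" if "z \<in> S" for z
    using bspec[OF T that] by (simp_all add: case_prod_beta) (metis fst_conv snd_conv)
  obtain F where F: "F \<subseteq> S" "finite F" "S \<subseteq> (\<Union>z\<in>F. snd (snd (t z)))"
  proof (rule compactE_image[OF S, of S "\<lambda>z. snd (snd (t z))"])
    show "S \<subseteq> (\<Union>z\<in>S. snd (snd (t z)))"
      using t(3) by auto
  qed (use t(2) in auto)
  \<comment> \<open>Inserting \<open>1\<close> and \<open>1/2\<close> keeps both maxima meaningful
    for empty \<open>F\<close> and forces \<open>1 \<le> l\<close> and \<open>0 < c\<close>, which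
    the local data do not give.\<close>
  define l where "l = Max (insert 1 ((\<lambda>z. fst (t z)) ` F))"
  define c where "c = Max (insert (1/2) ((\<lambda>z. fst (snd (t z))) ` F))"
  have "1 \<le> l"
    unfolding l_def using F by (intro Max_ge) auto
  moreover have "1/2 \<le> c"
    unfolding c_def using F by (intro Max_ge) auto
  moreover have "c < 1"
    unfolding c_def using F t(1) by (subst Max_less_iff) auto
  moreover have "EZ N f p dist l x y \<le> c * dist x y" if xy: "(x, y) \<in> S" for x y
  proof -
    obtain z where z: "z \<in> F" "(x, y) \<in> snd (snd (t z))"
      using F(3) xy by blast
    have "fst (t z) \<le> l"
      unfolding l_def using F z by (intro Max_ge) auto
    then have "EZ N f p dist l x y \<le> EZ N f p dist (fst (t z)) x y"
      by (rule decseqD[OF decseq_EZ_dist[OF p nea]])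
    also have "\<dots> \<le> fst (snd (t z)) * dist x y"
      using t(4)[of z x y] F z by auto
    also have "\<dots> \<le> c * dist x y"
      unfolding c_def using F z by (intro mult_right_mono Max_ge) auto
    finally show ?thesis .
  qed
  ultimately show ?thesis
    by (intro exI[of _ l] conjI bexI[of _ c] allI impI) auto
qed

text \<open>Off the diagonal \<open>dist\<close> is positive, so a rate slightly above that of LECA
  gives a strict inequality at \<open>(x, y)\<close>, which persists nearby by continuity.\<close>

lemma LECA_locally_contracting:
  fixes f :: "nat \<Rightarrow> 'a::metric_space \<Rightarrow> 'a"
  assumes p: "nondegenerate N p" and f: "\<And>i. i < N \<Longrightarrow> continuous_on UNIV (f i)"
    and leca: "LECA N f p dist" and ne: "x \<noteq> y"
  shows "\<exists>l. \<exists>c<1. \<exists>U. open U \<and> (x, y) \<in> U \<and>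
    (\<forall>(u, v)\<in>U. EZ N f p dist l u v \<le> c * dist u v)"
proof -
  obtain l c where lc: "0 < c" "c < 1" "EZ N f p dist l x y \<le> c * dist x y"
    using leca unfolding LECA_def by (meson greaterThanLessThan_iff)
  define c' where "c' = (1 + c) / 2"
  have c': "c < c'" "c' < 1"
    using lc by (auto simp: c'_def)
  define U where "U = {z. EZ N f p dist l (fst z) (snd z) < c' * dist (fst z) (snd z)}"
  have "open U"
    unfolding U_def by (intro open_Collect_less continuous_on_EZ_dist p f continuous_intros)
  moreover have "c * dist x y < c' * dist x y"
    using c' ne by (intro mult_strict_right_mono) auto
  then have "(x, y) \<in> U"
    using lc by (simp add: U_def)
  moreover have "\<forall>(u, v)\<in>U. EZ N f p dist l u v \<le> c' * dist u v"
    by (simp add: U_def case_prod_beta)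
  ultimately show ?thesis
    using c'(2) by blast
qed

text \<open>The supremum controls the off-diagonal pairs near \<open>(x, x)\<close>; on diagonal
  pairs both sides vanish.\<close>

lemma ESCA_locally_contracting:
  fixes f :: "nat \<Rightarrow> 'a::metric_space \<Rightarrow> 'a"
  assumes "ESCA N f p dist"
  shows "\<exists>l. \<exists>c<1. \<exists>U. open U \<and> (x, x) \<in> U \<and>
    (\<forall>(u, v)\<in>U. EZ N f p dist l u v \<le> c * dist u v)"
proof -
  obtain l V where V: "open V" "(x, x) \<in> V"
    and sup: "(SUP (y, z)\<in>{(y, z). (y, z) \<in> V \<and> y \<noteq> z}. ereal (EZ N f p dist l z y / dist z y)) < 1"
    using assms unfolding ESCA_def by meson
  \<comment> \<open>A real rate is taken strictly between the supremum and \<open>1\<close>, because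
    the supremum itself may be -\<infinity>.\<close>
  obtain c where c: "c < 1"
    "(SUP (y, z)\<in>{(y, z). (y, z) \<in> V \<and> y \<noteq> z}. ereal (EZ N f p dist l z y / dist z y)) < ereal c"
    using ereal_dense2[OF sup] by auto
  have "EZ N f p dist l u v \<le> c * dist u v" if uv: "(u, v) \<in> V" for u v
  proof (cases "u = v")
    case False
    have "ereal (EZ N f p dist l v u / dist v u) \<le>
        (SUP (y, z)\<in>{(y, z). (y, z) \<in> V \<and> y \<noteq> z}. ereal (EZ N f p dist l z y / dist z y))"
      using uv False by (intro SUP_upper2[of "(u, v)"]) auto
    then have "ereal (EZ N f p dist l v u / dist v u) < ereal c"
      using c(2) by (rule le_less_trans)
    then show ?thesis
      using False by (simp add: field_simps dist_commute EZ_dist_commute[of _ _ _ _ v u])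
  qed (simp add: EZ_dist_refl)
  then show ?thesis
    using V c by blast
qed


section \<open>Synchronization and the adapted metric\<close>

lemma SA_imp_LECA:
  fixes f :: "nat \<Rightarrow> 'a::metric_space \<Rightarrow> 'a"
  assumes "SA N f p dist"
  shows "LECA N f p dist"
  unfolding LECA_def
proof (intro allI)
  fix x y
  show "\<exists>l\<ge>1. \<exists>c\<in>{0<..<1}. EZ N f p dist l x y \<le> c * dist x y"
  proof (cases "x = y")
    case True
    then show ?thesis
      by (intro exI[of _ 1] conjI bexI[of _ "1/2"]) (auto simp: EZ_dist_refl)
  next
    case False
    then have "\<forall>\<^sub>F n in sequentially. EZ N f p dist n x y < dist x y / 2"
      using assms by (intro order_tendstoD(2)) (auto simp: SA_def)
    then have "\<forall>\<^sub>F n in sequentially. n \<ge> 1 \<and> EZ N f p dist n x y < dist x y / 2"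
      using eventually_ge_at_top[of 1] by eventually_elim simp
    then obtain l where "l \<ge> 1" "EZ N f p dist l x y < dist x y / 2"
      by (auto dest: eventually_happens)
    then show ?thesis
      by (intro exI[of _ l] conjI bexI[of _ "1/2"]) auto
  qed
qed

lemma LECA_imp_SA:
  fixes f :: "nat \<Rightarrow> 'a::metric_space \<Rightarrow> 'a"
  assumes comp: "compact (UNIV :: 'a set)" and p: "nondegenerate N p"
    and f: "\<And>i. i < N \<Longrightarrow> continuous_on UNIV (f i)"
    and nea: "NEA N f p dist" and leca: "LECA N f p dist"
  shows "SA N f p dist"
  unfolding SA_def
proof (intro allI)
  fix x y
  let ?E = "EZ N f p dist"
  obtain L where L: "(\<lambda>n. ?E n x y) \<longlonglongrightarrow> L" "\<And>n. L \<le> ?E n x y"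
    using decseq_convergent[OF decseq_EZ_dist[OF p nea], of 0 x y] EZ_dist_nonneg by metis
  have "L \<le> \<delta>" if \<delta>: "\<delta> > 0" for \<delta>
  proof -
    \<comment> \<open>Away from the diagonal LECA alone contracts locally, and \<open>S\<close> is
      compact.\<close>
    define S where "S = {z :: 'a \<times> 'a. \<delta> \<le> dist (fst z) (snd z)}"
    have "closed S"
      unfolding S_def by (intro closed_Collect_le continuous_intros)
    moreover have "compact (UNIV :: ('a \<times> 'a) set)"
      using compact_Times[OF comp comp] by simp
    ultimately have "compact S"
      using compact_Int_closed by fastforce
    moreover have "\<exists>l. \<exists>c<1. \<exists>U. open U \<and> z \<in> U \<and> (\<forall>(u, v)\<in>U. ?E l u v \<le> c * dist u v)"
      if "z \<in> S" for z
    proof -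
      have "fst z \<noteq> snd z"
        using that \<delta> by (auto simp: S_def)
      from LECA_locally_contracting[OF p f leca this] show ?thesis by simp
    qed
    ultimately have "\<exists>l\<ge>1. \<exists>c\<in>{0<..<1}. \<forall>u v. (u, v) \<in> S \<longrightarrow> ?E l u v \<le> c * dist u v"
      by (rule uniform_contraction[OF p nea])
    then obtain l c where "c \<in> {0<..<1}"
      and le: "\<forall>u v. (u, v) \<in> S \<longrightarrow> ?E l u v \<le> c * dist u v"
      by blast
    then have c: "c < 1"
      by simp
    define C where "C = 1 / (1 - c)"
    have C: "0 < C" "C * (1 - c) = 1"
      using c by (auto simp: C_def)
    \<comment> \<open>For far pairs this rearranges \<open>?E l u v \<le> c * dist u v\<close>; for
      near pairs \<open>\<delta>\<close> suffices, as the bracket is nonnegative.\<close>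
    have bound: "dist u v \<le> \<delta> + C * (dist u v - ?E l u v)" for u v
    proof (cases "\<delta> \<le> dist u v")
      case True
      have "dist u v = C * (1 - c) * dist u v"
        using C by simp
      also have "\<dots> = C * (dist u v - c * dist u v)"
        by (simp add: algebra_simps)
      also have "\<dots> \<le> C * (dist u v - ?E l u v)"
        using C le True by (intro mult_left_mono) (auto simp: S_def)
      finally show ?thesis using \<delta> by simp
    next
      case False
      have "?E l u v \<le> ?E 0 u v"
        by (rule decseqD[OF decseq_EZ_dist[OF p nea]]) simp
      then have "0 \<le> C * (dist u v - ?E l u v)"
        using C by (simp add: EZ_0[OF p])
      then show ?thesis using False by simp
    qed
    \<comment> \<open>Applying \<open>avg ^^ k\<close> to \<open>bound\<close> turns
      \<open>dist\<close> into \<open>?E k\<close> and \<open>?E l\<close> into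
      \<open>?E (k + l)\<close>.\<close>
    have "?E k x y \<le> \<delta> + C * (?E k x y - ?E (k + l) x y)" for k
      using funpow_avg_mono[where k = k and f = f and x = x and y = y, OF p bound]
      by (simp add: funpow_avg_affine[OF p] EZ_eq_funpow[OF p] funpow_add)
    moreover have "(\<lambda>k. \<delta> + C * (?E k x y - ?E (k + l) x y)) \<longlonglongrightarrow> \<delta> + C * (L - L)"
      using L(1) by (intro tendsto_intros) (auto intro: LIMSEQ_ignore_initial_segment)
    ultimately show "L \<le> \<delta>"
      using LIMSEQ_le[OF L(1)] by fastforce
  qed
  then have "L \<le> 0"
    using field_le_epsilon[of L 0] by simp
  moreover have "0 \<le> L"
    using L(1) by (rule LIMSEQ_le_const) (auto simp: EZ_dist_nonneg)
  ultimately show "(\<lambda>n. ?E n x y) \<longlonglongrightarrow> 0"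
    using L(1) by simp
qed

text \<open>Averaging moves each summand to the next time. In the geometric sum this costs a factor
  \<open>r\<close> and trades the term at time \<open>0\<close> for the one at time
  \<open>n\<close>, which \<open>le\<close> shows to be no larger.\<close>

lemma CA_adapted_dist:
  fixes f :: "nat \<Rightarrow> 'a::metric_space \<Rightarrow> 'a"
  assumes p: "nondegenerate N p" and n: "n \<ge> 1" and c: "0 < c" "c < 1"
    and le: "\<And>x y. EZ N f p dist n x y \<le> c * dist x y"
  shows "CA N f p (adapted_dist N f p n c)"
  unfolding CA_def
proof (intro bexI allI)
  let ?E = "EZ N f p dist"
  \<comment> \<open>The \<open>n\<close>-th root of \<open>c\<close> makes the weights geometric
    with ratio \<open>1 / r\<close>.\<close>
  define r where "r = c powr (1 / real n)"
  have "0 < r" "r powr real n = c"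
    using n c by (auto simp: r_def powr_powr)
  then have rn: "r ^ n = c"
    by (simp add: powr_realpow)
  show r: "r \<in> {0<..<1}"
    using n c powr_less_mono2[of "1 / real n" c 1] by (auto simp: r_def)
  have w: "c powr (- (real j / real n)) = (1 / r) ^ j" for j
  proof -
    have "c powr (- (real j / real n)) = r powr (- real j)"
      by (simp add: r_def powr_powr)
    then show ?thesis
      using \<open>0 < r\<close> by (simp add: powr_minus powr_realpow power_one_over inverse_eq_divide)
  qed
  have D: "adapted_dist N f p n c x y = (\<Sum>j<n. (1 / r) ^ j * ?E j x y)" for x y
    by (simp add: adapted_dist_def w)
  fix x y
  have "EZ N f p (adapted_dist N f p n c) 1 x y = (\<Sum>i<N. \<Sum>j<n. p i * ((1 / r) ^ j * ?E j (f i x) (f i y)))"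
    by (simp add: EZ_Suc_0[OF p] avg_def D sum_distrib_left)
  also have "\<dots> = (\<Sum>j<n. (1 / r) ^ j * ?E (Suc j) x y)"
    by (subst sum.swap) (simp add: EZ_Suc[OF p] avg_def sum_distrib_left algebra_simps)
  also have "\<dots> = r * (\<Sum>j<n. (1 / r) ^ Suc j * ?E (Suc j) x y)"
    using \<open>0 < r\<close> by (simp add: sum_distrib_left)
  also have "(\<Sum>j<n. (1 / r) ^ Suc j * ?E (Suc j) x y)
      = (\<Sum>j<n. (1 / r) ^ j * ?E j x y) + (1 / r) ^ n * ?E n x y - ?E 0 x y"
    using sum.lessThan_Suc_shift[of "\<lambda>j. (1 / r) ^ j * ?E j x y" n] by simp
  \<comment> \<open>The boundary weight is \<open>1 / c\<close>, exactly cancelling the rate in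
    \<open>le\<close>.\<close>
  also have "(1 / r) ^ n * ?E n x y \<le> ?E 0 x y"
    using le[of x y] c by (simp add: EZ_0[OF p] power_one_over rn field_simps)
  finally show "EZ N f p (adapted_dist N f p n c) 1 x y \<le> r * adapted_dist N f p n c x y"
    using r by (simp add: D[of x y])
qed

theorem theorem1p1:
  fixes f :: "nat \<Rightarrow> 'a::metric_space \<Rightarrow> 'a" and p :: "nat \<Rightarrow> real" and N :: nat
  assumes "compact (UNIV :: 'a set)"
    and "N \<ge> 2"
    and "nondegenerate N p"
    and "\<And>i. i < N \<Longrightarrow> \<exists>L. lipschitz_on L UNIV (f i)"
    and "NEA N f p dist"
  shows "(LECA N f p dist \<and> ESCA N f p dist \<longrightarrow>
           (\<exists>c\<in>{0<..<1}. \<exists>n\<ge>1. CA N f p (adapted_dist N f p n c)))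
         \<and> (LECA N f p dist \<longleftrightarrow> SA N f p dist)"
proof -
  have f: "continuous_on UNIV (f i)" if "i < N" for i
    using assms(4)[OF that] lipschitz_on_continuous_on by blast
  have "\<exists>c\<in>{0<..<1}. \<exists>n\<ge>1. CA N f p (adapted_dist N f p n c)"
    if leca: "LECA N f p dist" and esca: "ESCA N f p dist"
  proof -
    have "compact (UNIV :: ('a \<times> 'a) set)"
      using compact_Times[OF assms(1) assms(1)] by simp
    moreover have "\<exists>l. \<exists>c<1. \<exists>U. open U \<and> z \<in> U \<and>
        (\<forall>(u, v)\<in>U. EZ N f p dist l u v \<le> c * dist u v)" for z
      \<comment> \<open>ESCA covers the diagonal pairs, LECA all others.\<close>
      using LECA_locally_contracting[OF assms(3) f leca, of "fst z" "snd z"]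
        ESCA_locally_contracting[OF esca, of "fst z"]
      by (cases z; cases "fst z = snd z") auto
    ultimately have "\<exists>n\<ge>1. \<exists>c\<in>{0<..<1}. \<forall>x y. (x, y) \<in> UNIV \<longrightarrow>
        EZ N f p dist n x y \<le> c * dist x y"
      by (rule uniform_contraction[OF assms(3,5)])
    then obtain n c where n: "n \<ge> 1" and c: "c \<in> {0<..<1}"
      and "\<forall>x y. EZ N f p dist n x y \<le> c * dist x y"
      by blast
    then have "CA N f p (adapted_dist N f p n c)"
      by (intro CA_adapted_dist assms(3)) auto
    then show ?thesis
      using n c by blast
  qed
  then show ?thesis
    using LECA_imp_SA[OF assms(1,3) f assms(5)] SA_imp_LECA by blast
qed

end
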